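(* Let $n\le 4$ be a positive integer and let $M$ be an $n\times n$ $(0,1)$-matrix with no zero row and no zero column. Then $M$ supports a unitary matrix if and only if $M$ is strongly quadrangular.
   Context: A $(0,1)$-matrix $M$ of degree $n$ (i.e. $n\times n$) supports a unitary if there exists an $n\times n$ complex unitary matrix $U$ such that, for all $i,j$, $U_{ij}\neq0$ if and only if $M_{ij}=1$. $M$ is row-strongly-quadrangular if for every set $S$ of rows of $M$ (rows indexed by position) such that each $u\in S$ has another row $v\in S$, $v\neq u$, with $\langle u,v\rangle\neq 0$, the number of columns containing at least two ones within the rows of $S$ is at least $|S|$. $M$ is strongly quadrangular if both $M$ and its transpose $M^T$ are row-strongly-quadrangular. *)

theory Defs
  imports "Jordan_Normal_Form.Schur_Decomposition"
begin

definition zero_one_mat :: "int mat \<Rightarrow> bool" where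
  "zero_one_mat M \<longleftrightarrow> elements_mat M \<subseteq> {0, 1}"

definition unitary_mat :: "complex mat \<Rightarrow> bool" where
  "unitary_mat U \<longleftrightarrow>
     square_mat U \<and> inverts_mat U (mat_adjoint U) \<and> inverts_mat (mat_adjoint U) U"

definition supports_unitary :: "int mat \<Rightarrow> bool" where
  "supports_unitary M \<longleftrightarrow>
     (\<exists>U \<in> carrier_mat (dim_row M) (dim_col M). unitary_mat U \<and>
        (\<forall>i < dim_row M. \<forall>j < dim_col M. U $$ (i, j) \<noteq> 0 \<longleftrightarrow> M $$ (i, j) = 1))"

text \<open>Sets of rows are sets of row indices, so equal rows at different positions count
  separately.\<close>

definition row_strongly_quadrangular :: "int mat \<Rightarrow> bool" where
  "row_strongly_quadrangular M \<longleftrightarrow>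
     (\<forall>S \<subseteq> {..<dim_row M}.
        (\<forall>u \<in> S. \<exists>v \<in> S. v \<noteq> u \<and> row M u \<bullet> row M v \<noteq> 0) \<longrightarrow>
        card S \<le> card {j. j < dim_col M \<and> 2 \<le> card {i \<in> S. M $$ (i, j) = 1}})"

definition strongly_quadrangular :: "int mat \<Rightarrow> bool" where
  "strongly_quadrangular M \<longleftrightarrow>
     row_strongly_quadrangular M \<and> row_strongly_quadrangular (transpose_mat M)"

end

theory Submission
  imports Defs
begin

text \<open>Necessity holds in every degree. Let \<open>S\<close> be a set of rows of a unitary matrix, each of which
overlaps another one, and let \<open>T\<close> be the set of columns in which at least two rows of \<open>S\<close> are
nonzero. A column outside \<open>T\<close> contributes nothing to the inner product of two rows of \<open>S\<close>, so
the restrictions of these rows to \<open>T\<close> are still orthogonal, and none of them vanishes. Orthogonal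
nonzero vectors are linearly independent, hence \<open>card S \<le> card T\<close>
(\<open>card_le_of_orthogonal\<close>, \<open>orthogonal_support_imp_row_sq\<close>). The transpose of a unitary
matrix is unitary, which gives the condition on columns.

Conversely, two-element sets \<open>S\<close> already say that two rows never share exactly one column, and
likewise for columns. If a row has a single one, then the column of that one is otherwise zero, the
pattern is a direct sum with a block of size one, and the degree drops
(\<open>biquadrangular_isolated\<close>, \<open>orthogonal_support_add_isolated\<close>). What remains are the
patterns in which every row and every column has at least two ones.
In degree at most three these have at most one zero. In degree four there are two cases:

  \<^item> Some row has exactly two ones, in columns \<open>p\<close> and \<open>q\<close>. Any other row contains both of
    these columns or neither, and the same argument for columns leaves four patterns that carry
    orthogonal rows, and one that does not: two rows supported on \<open>{p, q}\<close> and two full rows.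
    This last pattern is the only place where a set of three rows is needed
    (\<open>orthogonal_support_two_entry_row\<close>). A column with exactly two ones is the
    transposed situation.

  \<^item> Every row and every column has at most one zero. Then the zeros lie on a diagonal of some
    arrangement of the rows and columns, and only their number matters
    (\<open>orthogonal_support_scattered_zeros\<close>).

In each case an integer matrix with orthogonal rows and the required support is written down.
Normalizing its rows makes it unitary. Rows and columns are indexed by arbitrary sets, so that
an arrangement of a pattern is a choice of names for the indices, and a submatrix is a choice of
smaller index sets.\<close>

section \<open>Orthogonal families with prescribed support\<close>

text \<open>The rows of \<open>U\<close> are only required to be orthogonal, not normalized: when no row of the
pattern is empty, scaling repairs this without changing the support, and integer witnesses become
possible.\<close>

definition orthogonal_support :: "'a set \<Rightarrow> 'b set \<Rightarrow> ('a \<Rightarrow> 'b \<Rightarrow> bool) \<Rightarrow> bool" where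
  "orthogonal_support R C P \<longleftrightarrow>
     (\<exists>U :: 'a \<Rightarrow> 'b \<Rightarrow> complex.
        (\<forall>i\<in>R. \<forall>i'\<in>R. i \<noteq> i' \<longrightarrow> (\<Sum>j\<in>C. U i j * cnj (U i' j)) = 0) \<and>
        (\<forall>i\<in>R. \<forall>j\<in>C. U i j \<noteq> 0 \<longleftrightarrow> P i j))"

text \<open>Two rows with entries in \<open>{0, 1}\<close> have a nonzero inner product exactly if they share a column.\<close>

definition row_sq :: "'a set \<Rightarrow> 'b set \<Rightarrow> ('a \<Rightarrow> 'b \<Rightarrow> bool) \<Rightarrow> bool" where
  "row_sq R C P \<longleftrightarrow>
     (\<forall>S\<subseteq>R. (\<forall>u\<in>S. \<exists>v\<in>S. v \<noteq> u \<and> (\<exists>j\<in>C. P u j \<and> P v j)) \<longrightarrow>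
        card S \<le> card {j\<in>C. 2 \<le> card {i\<in>S. P i j}})"

text \<open>The case \<open>card S = 2\<close> of strong quadrangularity. Unlike the full condition it is a first-order
property of the pattern, suited to case distinctions on entries.\<close>

definition quadrangular :: "'a set \<Rightarrow> 'b set \<Rightarrow> ('a \<Rightarrow> 'b \<Rightarrow> bool) \<Rightarrow> bool" where
  "quadrangular R C P \<longleftrightarrow>
     (\<forall>x\<in>R. \<forall>y\<in>R. x \<noteq> y \<longrightarrow> (\<forall>j\<in>C. P x j \<and> P y j \<longrightarrow> (\<exists>k\<in>C. k \<noteq> j \<and> P x k \<and> P y k)))"

text \<open>Bessel's inequality for the standard unit vectors: the squared lengths of the projections of the
unit vector \<open>e\<^sub>t\<close> to the lines spanned by the vectors \<open>U i\<close> sum to at most one. Summed over \<open>t\<close>,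
each vector \<open>U i\<close> contributes exactly one.\<close>

lemma card_le_of_orthogonal:
  fixes U :: "'a \<Rightarrow> 'b \<Rightarrow> complex"
  assumes fin: "finite S" "finite T"
    and orth: "\<And>i k. i \<in> S \<Longrightarrow> k \<in> S \<Longrightarrow> i \<noteq> k \<Longrightarrow> (\<Sum>j\<in>T. U i j * cnj (U k j)) = 0"
    and nz: "\<And>i. i \<in> S \<Longrightarrow> \<exists>j\<in>T. U i j \<noteq> 0"
  shows "card S \<le> card T"
proof -
  define N where "N i = (\<Sum>j\<in>T. (cmod (U i j))\<^sup>2)" for i
  have Npos: "N i > 0" if "i \<in> S" for i
  proof -
    have "\<exists>j\<in>T. U i j \<noteq> 0" using nz that .
    then obtain j where "j \<in> T" "U i j \<noteq> 0" by blast
    then show ?thesis unfolding N_def by (intro sum_pos2[of T j]) (auto simp: fin)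
  qed
  have Nsum: "(\<Sum>j\<in>T. U i j * cnj (U i j)) = of_real (N i)" for i
    unfolding N_def by (simp only: of_real_sum complex_norm_square)
  have bessel: "(\<Sum>i\<in>S. (cmod (U i t))\<^sup>2 / N i) \<le> 1" if t: "t \<in> T" for t
  proof -
    \<comment> \<open>The vector \<open>w\<close> is the component of the unit vector at \<open>t\<close> orthogonal to all \<open>U i\<close>. As it is a
      projection, its squared length is its own entry at \<open>t\<close>.\<close>
    define c where "c i = cnj (U i t) / of_real (N i)" for i
    define w where "w j = (if j = t then 1 else 0) - (\<Sum>i\<in>S. c i * U i j)" for j
    have perp: "(\<Sum>j\<in>T. w j * cnj (U k j)) = 0" if k: "k \<in> S" for k
    proof -
      have "(\<Sum>j\<in>T. w j * cnj (U k j)) =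
          (\<Sum>j\<in>T. (if j = t then cnj (U k j) else 0)) - (\<Sum>j\<in>T. \<Sum>i\<in>S. c i * (U i j * cnj (U k j)))"
        unfolding w_def sum_subtractf[symmetric]
        by (intro sum.cong) (auto simp: algebra_simps sum_distrib_left)
      also have "(\<Sum>j\<in>T. \<Sum>i\<in>S. c i * (U i j * cnj (U k j))) =
          (\<Sum>i\<in>S. c i * (\<Sum>j\<in>T. U i j * cnj (U k j)))"
        by (subst sum.swap) (simp add: sum_distrib_left)
      also have "\<dots> = (\<Sum>i\<in>S. if i = k then c k * of_real (N k) else 0)"
        using orth k by (intro sum.cong) (auto simp: Nsum)
      also have "\<dots> = cnj (U k t)"
        using k fin Npos[OF k] by (simp add: c_def)
      finally show ?thesis using t fin by simp
    qed
    have "(\<Sum>j\<in>T. w j * cnj (w j)) =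
        (\<Sum>j\<in>T. if j = t then w j else 0) - (\<Sum>j\<in>T. \<Sum>i\<in>S. cnj (c i) * (w j * cnj (U i j)))"
      unfolding sum_subtractf[symmetric]
    proof (intro sum.cong refl)
      fix j
      have "cnj (w j) = (if j = t then 1 else 0) - (\<Sum>i\<in>S. cnj (c i) * cnj (U i j))"
        unfolding w_def by simp
      then show "w j * cnj (w j) = (if j = t then w j else 0) - (\<Sum>i\<in>S. cnj (c i) * (w j * cnj (U i j)))"
        by (simp add: right_diff_distrib sum_distrib_left mult.left_commute)
    qed
    also have "(\<Sum>j\<in>T. \<Sum>i\<in>S. cnj (c i) * (w j * cnj (U i j))) =
        (\<Sum>i\<in>S. cnj (c i) * (\<Sum>j\<in>T. w j * cnj (U i j)))"
      by (subst sum.swap) (simp add: sum_distrib_left)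
    also have "\<dots> = 0" using perp by simp
    finally have "(\<Sum>j\<in>T. w j * cnj (w j)) = w t" using t fin by simp
    moreover have "(\<Sum>j\<in>T. w j * cnj (w j)) = of_real (\<Sum>j\<in>T. (cmod (w j))\<^sup>2)"
      by (simp only: of_real_sum complex_norm_square)
    moreover have "w t = of_real (1 - (\<Sum>i\<in>S. (cmod (U i t))\<^sup>2 / N i))"
      unfolding w_def c_def
      by (simp only: of_real_diff of_real_sum of_real_divide complex_norm_square of_real_1) (simp add: mult.commute)
    ultimately have "(\<Sum>j\<in>T. (cmod (w j))\<^sup>2) = 1 - (\<Sum>i\<in>S. (cmod (U i t))\<^sup>2 / N i)"
      by (metis of_real_eq_iff)
    moreover have "0 \<le> (\<Sum>j\<in>T. (cmod (w j))\<^sup>2)" by (simp add: sum_nonneg)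
    ultimately show ?thesis by linarith
  qed
  have "real (card S) = (\<Sum>i\<in>S. \<Sum>t\<in>T. (cmod (U i t))\<^sup>2 / N i)"
  proof -
    have "(\<Sum>t\<in>T. (cmod (U i t))\<^sup>2 / N i) = 1" if "i \<in> S" for i
      using Npos[OF that] unfolding sum_divide_distrib[symmetric] N_def[symmetric] by simp
    then show ?thesis by simp
  qed
  also have "\<dots> = (\<Sum>t\<in>T. \<Sum>i\<in>S. (cmod (U i t))\<^sup>2 / N i)" by (rule sum.swap)
  also have "\<dots> \<le> (\<Sum>t\<in>T. 1)" by (intro sum_mono bessel)
  finally show ?thesis by simp
qed

lemma two_le_cardD:
  assumes "2 \<le> card A" shows "\<exists>y\<in>A. y \<noteq> x"
proof (rule ccontr)
  assume "\<not> (\<exists>y\<in>A. y \<noteq> x)"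
  then have "A \<subseteq> {x}" by auto
  then have "card A \<le> card {x}" by (intro card_mono) auto
  then show False using assms by simp
qed

lemma two_le_cardI:
  assumes "finite A" "x \<in> A" "y \<in> A" "x \<noteq> y" shows "2 \<le> card A"
  using card_mono[of A "{x, y}"] assms by simp

text \<open>Restricting the rows in \<open>S\<close> to the columns that at least two of them meet loses no summand of any
inner product between different rows, so the counting bound applies to the restrictions.\<close>

lemma orthogonal_support_imp_row_sq:
  assumes fin: "finite R" "finite C" and "orthogonal_support R C P"
  shows "row_sq R C P"
  unfolding row_sq_def
proof (intro allI impI)
  fix S assume S: "S \<subseteq> R" and nb: "\<forall>u\<in>S. \<exists>v\<in>S. v \<noteq> u \<and> (\<exists>j\<in>C. P u j \<and> P v j)"
  obtain U :: "'a \<Rightarrow> 'b \<Rightarrow> complex" where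
    orth: "\<And>i k. i \<in> R \<Longrightarrow> k \<in> R \<Longrightarrow> i \<noteq> k \<Longrightarrow> (\<Sum>j\<in>C. U i j * cnj (U k j)) = 0" and
    supp: "\<And>i j. i \<in> R \<Longrightarrow> j \<in> C \<Longrightarrow> U i j \<noteq> 0 \<longleftrightarrow> P i j"
    using assms(3) unfolding orthogonal_support_def by blast
  have finS: "finite S" using S fin finite_subset by auto
  define T where "T = {j\<in>C. 2 \<le> card {i\<in>S. P i j}}"
  have inT: "j \<in> T" if "i \<in> S" "k \<in> S" "i \<noteq> k" "j \<in> C" "P i j" "P k j" for i k j
    unfolding T_def using that two_le_cardI[of "{i\<in>S. P i j}" i k] finS by auto
  have "card S \<le> card T"
  proof (rule card_le_of_orthogonal)
    show "finite S" "finite T" using finS fin by (auto simp: T_def)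
    show "(\<Sum>j\<in>T. U i j * cnj (U k j)) = 0" if "i \<in> S" "k \<in> S" "i \<noteq> k" for i k
    proof -
      have "(\<Sum>j\<in>T. U i j * cnj (U k j)) = (\<Sum>j\<in>C. U i j * cnj (U k j))"
      proof (rule sum.mono_neutral_left)
        show "\<forall>j\<in>C - T. U i j * cnj (U k j) = 0"
        proof
          fix j assume j: "j \<in> C - T"
          then have "\<not> (P i j \<and> P k j)" using inT[OF that, of j] by auto
          then show "U i j * cnj (U k j) = 0"
            using supp[of i j] supp[of k j] j S that by auto
        qed
      qed (auto simp: fin T_def)
      then show ?thesis using orth that S by auto
    qed
    show "\<exists>j\<in>T. U i j \<noteq> 0" if i: "i \<in> S" for i
    proof -
      obtain v j where "v \<in> S" "v \<noteq> i" "j \<in> C" "P i j" "P v j" using nb i by blast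
      then have "j \<in> T" "U i j \<noteq> 0" using inT[of i v j] supp[of i j] i S by auto
      then show ?thesis by blast
    qed
  qed
  then show "card S \<le> card {j\<in>C. 2 \<le> card {i\<in>S. P i j}}" unfolding T_def .
qed

lemma row_sqD:
  assumes "row_sq R C P" "S \<subseteq> R" "\<forall>u\<in>S. \<exists>v\<in>S. v \<noteq> u \<and> (\<exists>j\<in>C. P u j \<and> P v j)"
  shows "card S \<le> card {j\<in>C. 2 \<le> card {i\<in>S. P i j}}"
  using assms(1)[unfolded row_sq_def, rule_format, OF assms(2)] assms(3) by blast

lemma row_sq_imp_quadrangular:
  assumes "row_sq R C P"
  shows "quadrangular R C P"
  unfolding quadrangular_def
proof (intro ballI impI)
  fix x y j assume xy: "x \<in> R" "y \<in> R" "x \<noteq> y" and j: "j \<in> C" "P x j \<and> P y j"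
  have "\<forall>u\<in>{x, y}. \<exists>v\<in>{x, y}. v \<noteq> u \<and> (\<exists>j\<in>C. P u j \<and> P v j)" using xy j by auto
  moreover have "{x, y} \<subseteq> R" using xy by simp
  ultimately have "card {x, y} \<le> card {j\<in>C. 2 \<le> card {i\<in>{x, y}. P i j}}"
    using row_sqD[OF assms, of "{x, y}"] by blast
  then have "2 \<le> card {j\<in>C. 2 \<le> card {i\<in>{x, y}. P i j}}" using xy by simp
  then obtain k where k: "k \<noteq> j" "k \<in> C" "2 \<le> card {i\<in>{x, y}. P i k}"
    using two_le_cardD[of _ j] by blast
  obtain u where "u \<noteq> x" "u \<in> {x, y}" "P u k" using two_le_cardD[OF k(3), of x] by blast
  moreover obtain v where "v \<noteq> y" "v \<in> {x, y}" "P v k" using two_le_cardD[OF k(3), of y] by blast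
  ultimately show "\<exists>k\<in>C. k \<noteq> j \<and> P x k \<and> P y k" using k by blast
qed

section \<open>Constructions of orthogonal families\<close>

text \<open>Orthogonality of the rows of an explicit integer matrix is decided by simplification. The lists
\<open>rs\<close> and \<open>cs\<close> arrange the index sets so that the pattern matches the matrix.\<close>

lemma orthogonal_support_lists:
  fixes W :: "int list list"
  assumes rs: "distinct rs" and cs: "distinct cs"
    and orth: "sorted_wrt (\<lambda>v w. (\<Sum>(x, y)\<leftarrow>zip v w. x * y) = 0) W"
    and supp: "list_all2 (\<lambda>i w. list_all2 (\<lambda>j x. P i j \<longleftrightarrow> x \<noteq> 0) cs w) rs W"
  shows "orthogonal_support (set rs) (set cs) P"
proof -
  have lenW: "length W = length rs" using supp by (simp add: list_all2_lengthD)
  have supp': "list_all2 (\<lambda>j x. P (rs ! k) j \<longleftrightarrow> x \<noteq> 0) cs (W ! k)" if "k < length rs" for k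
    using list_all2_nthD[OF supp that] .
  have lenw: "length (W ! k) = length cs" if "k < length rs" for k
    using supp'[OF that] by (simp add: list_all2_lengthD)
  define w where "w i = the (map_of (zip rs W) i)" for i
  define U :: "'a \<Rightarrow> 'b \<Rightarrow> complex" where "U i j = of_int (the (map_of (zip cs (w i)) j))" for i j
  have w_nth: "w (rs ! k) = W ! k" if "k < length rs" for k
    using that lenW rs by (simp add: w_def map_of_zip_nth)
  have U_nth: "U (rs ! k) (cs ! l) = of_int (W ! k ! l)" if "k < length rs" "l < length cs" for k l
    using that lenw cs by (simp add: U_def w_nth map_of_zip_nth)
  have prod: "(\<Sum>j\<in>set cs. U (rs ! k) j * cnj (U (rs ! m) j)) =
      of_int (\<Sum>(x, y)\<leftarrow>zip (W ! k) (W ! m). x * y)"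
    if km: "k < length rs" "m < length rs" for k m
  proof -
    have "(\<Sum>j\<in>set cs. U (rs ! k) j * cnj (U (rs ! m) j)) =
        (\<Sum>l<length cs. U (rs ! k) (cs ! l) * cnj (U (rs ! m) (cs ! l)))"
      by (rule sum.reindex_bij_betw[symmetric]) (simp add: bij_betw_nth cs)
    also have "\<dots> = (\<Sum>l<length cs. of_int (W ! k ! l * W ! m ! l))"
      using km by (intro sum.cong) (auto simp: U_nth)
    also have "\<dots> = of_int (\<Sum>(x, y)\<leftarrow>zip (W ! k) (W ! m). x * y)"
      using km by (simp add: sum_list_sum_nth lenw atLeast0LessThan)
    finally show ?thesis .
  qed
  have orth': "(\<Sum>(x, y)\<leftarrow>zip (W ! k) (W ! m). x * y) = 0"
    if "k < length rs" "m < length rs" "k < m" for k m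
    using orth that lenW by (simp add: sorted_wrt_iff_nth_less)
  have zero: "(\<Sum>j\<in>set cs. U (rs ! k) j * cnj (U (rs ! m) j)) = 0"
    if "k < length rs" "m < length rs" "k < m" for k m
    using prod orth' that by simp
  have "(\<Sum>j\<in>set cs. U i j * cnj (U i' j)) = 0" if ii: "i \<in> set rs" "i' \<in> set rs" "i \<noteq> i'" for i i'
  proof -
    obtain k m where km: "k < length rs" "m < length rs" "i = rs ! k" "i' = rs ! m"
      using ii by (metis in_set_conv_nth)
    then consider "k < m" | "m < k" using ii(3) by (metis nat_neq_iff)
    then show ?thesis
    proof cases
      case 1 then show ?thesis using zero km by simp
    next
      case 2
      have "(\<Sum>j\<in>set cs. U i j * cnj (U i' j)) = cnj (\<Sum>j\<in>set cs. U i' j * cnj (U i j))"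
        by (simp add: mult.commute)
      then show ?thesis using zero[of m k] 2 km by simp
    qed
  qed
  moreover have "U i j \<noteq> 0 \<longleftrightarrow> P i j" if ij: "i \<in> set rs" "j \<in> set cs" for i j
  proof -
    obtain k l where kl: "k < length rs" "l < length cs" "i = rs ! k" "j = cs ! l"
      using ij by (metis in_set_conv_nth)
    then show ?thesis using list_all2_nthD[OF supp'[OF kl(1)] kl(2)] U_nth[OF kl(1,2)] by simp
  qed
  ultimately show ?thesis unfolding orthogonal_support_def by (intro exI[of _ U] conjI ballI impI)
qed

lemma orthogonal_support_add_isolated:
  fixes P :: "'a \<Rightarrow> 'b \<Rightarrow> bool"
  assumes fin: "finite C"
    and ap: "a \<in> R" "p \<in> C" "P a p"
    and row: "\<And>j. j \<in> C \<Longrightarrow> P a j \<Longrightarrow> j = p"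
    and col: "\<And>i. i \<in> R \<Longrightarrow> P i p \<Longrightarrow> i = a"
    and "orthogonal_support (R - {a}) (C - {p}) P"
  shows "orthogonal_support R C P"
proof -
  obtain U :: "'a \<Rightarrow> 'b \<Rightarrow> complex" where
    orth: "\<And>i k. i \<in> R - {a} \<Longrightarrow> k \<in> R - {a} \<Longrightarrow> i \<noteq> k \<Longrightarrow> (\<Sum>j\<in>C - {p}. U i j * cnj (U k j)) = 0" and
    supp: "\<And>i j. i \<in> R - {a} \<Longrightarrow> j \<in> C - {p} \<Longrightarrow> U i j \<noteq> 0 \<longleftrightarrow> P i j"
    using assms(7) unfolding orthogonal_support_def by blast
  define V where "V i j = (if i = a \<and> j = p then 1 else if i = a \<or> j = p then 0 else U i j)" for i j
  have orthV: "(\<Sum>j\<in>C. V i j * cnj (V k j)) = 0" if "i \<in> R" "k \<in> R" "i \<noteq> k" for i k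
  proof -
    have "(\<Sum>j\<in>C. V i j * cnj (V k j)) = (\<Sum>j\<in>C - {p}. V i j * cnj (V k j))"
      using fin ap that by (subst sum.remove[of _ p]) (auto simp: V_def)
    also have "\<dots> = 0"
    proof (cases "i = a \<or> k = a")
      case True
      then show ?thesis by (intro sum.neutral) (auto simp: V_def)
    next
      case False
      then have "(\<Sum>j\<in>C - {p}. V i j * cnj (V k j)) = (\<Sum>j\<in>C - {p}. U i j * cnj (U k j))"
        by (intro sum.cong) (auto simp: V_def)
      then show ?thesis using orth False that by simp
    qed
    finally show ?thesis .
  qed
  have suppV: "V i j \<noteq> 0 \<longleftrightarrow> P i j" if "i \<in> R" "j \<in> C" for i j
  proof -
    consider "i = a" "j = p" | "i = a" "j \<noteq> p" | "i \<noteq> a" "j = p" | "i \<noteq> a" "j \<noteq> p" by blast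
    then show ?thesis
    proof cases
      case 1 then show ?thesis using ap by (simp add: V_def)
    next
      case 2 then have "\<not> P i j" using row that by metis
      then show ?thesis using 2 by (simp add: V_def)
    next
      case 3 then have "\<not> P i j" using col that by metis
      then show ?thesis using 3 by (simp add: V_def)
    next
      case 4 then show ?thesis using supp[of i j] that by (simp add: V_def)
    qed
  qed
  show ?thesis
    unfolding orthogonal_support_def by (intro exI[of _ V] conjI ballI impI orthV suppV)
qed

section \<open>Quadrangular patterns of degree at most three\<close>

definition biquadrangular :: "'a set \<Rightarrow> 'b set \<Rightarrow> ('a \<Rightarrow> 'b \<Rightarrow> bool) \<Rightarrow> bool" where
  "biquadrangular R C P \<longleftrightarrow>
     quadrangular R C P \<and> quadrangular C R (\<lambda>j i. P i j) \<and>
     (\<forall>i\<in>R. \<exists>j\<in>C. P i j) \<and> (\<forall>j\<in>C. \<exists>i\<in>R. P i j)"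

lemma quadrangularD:
  assumes "quadrangular R C P" "x \<in> R" "y \<in> R" "x \<noteq> y" "j \<in> C" "P x j" "P y j"
  shows "\<exists>k\<in>C. k \<noteq> j \<and> P x k \<and> P y k"
  using assms unfolding quadrangular_def by blast

text \<open>Another row through \<open>p\<close> would share only the column \<open>p\<close> with row \<open>a\<close>.
Deleting row \<open>a\<close> and column \<open>p\<close> preserves the conditions, as the deleted row and column take part in
no overlap.\<close>

lemma biquadrangular_isolated:
  assumes Q: "biquadrangular R C P" and a: "a \<in> R" and p: "p \<in> C"
    and row: "\<And>j. j \<in> C \<Longrightarrow> P a j \<longleftrightarrow> j = p"
  shows "\<And>i. i \<in> R \<Longrightarrow> P i p \<Longrightarrow> i = a" and "biquadrangular (R - {a}) (C - {p}) P"
proof -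
  show col: "i = a" if i: "i \<in> R" "P i p" for i
  proof (rule ccontr)
    assume "i \<noteq> a"
    then obtain k where "k \<in> C" "k \<noteq> p" "P a k"
      using quadrangularD[of R C P a i p] Q i a p row[OF p] unfolding biquadrangular_def by auto
    then show False using row by blast
  qed
  show "biquadrangular (R - {a}) (C - {p}) P"
    unfolding biquadrangular_def
  proof (intro conjI)
    show "quadrangular (R - {a}) (C - {p}) P"
      using Q col unfolding biquadrangular_def quadrangular_def by (metis Diff_iff singletonD)
    show "quadrangular (C - {p}) (R - {a}) (\<lambda>j i. P i j)"
      using Q row unfolding biquadrangular_def quadrangular_def by (metis Diff_iff singletonD)
    show "\<forall>i\<in>R - {a}. \<exists>j\<in>C - {p}. P i j"
      using Q col unfolding biquadrangular_def by (metis Diff_iff singletonD singletonI)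
    show "\<forall>j\<in>C - {p}. \<exists>i\<in>R - {a}. P i j"
      using Q row unfolding biquadrangular_def by (metis Diff_iff singletonD singletonI)
  qed
qed

text \<open>A column with a single one would, by the previous argument read for columns, also sit in a row
with a single one; so excluding such rows excludes such columns.\<close>

lemma biquadrangular_two_ones:
  assumes Q: "biquadrangular R C P"
    and ns: "\<And>a p. a \<in> R \<Longrightarrow> p \<in> C \<Longrightarrow> \<exists>j\<in>C. \<not> (P a j \<longleftrightarrow> j = p)"
  shows "\<And>i j. i \<in> R \<Longrightarrow> j \<in> C \<Longrightarrow> \<exists>k\<in>C. k \<noteq> j \<and> P i k"
    and "\<And>i j. i \<in> R \<Longrightarrow> j \<in> C \<Longrightarrow> \<exists>k\<in>R. k \<noteq> i \<and> P k j"
proof -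
  show rows: "\<exists>k\<in>C. k \<noteq> j \<and> P i k" if "i \<in> R" "j \<in> C" for i j
    using Q ns[OF that] that unfolding biquadrangular_def by metis
  show "\<exists>k\<in>R. k \<noteq> i \<and> P k j" if ij: "i \<in> R" "j \<in> C" for i j
  proof (cases "P i j")
    case True
    obtain k where k: "k \<in> C" "k \<noteq> j" "P i k" using rows ij by blast
    have "quadrangular C R (\<lambda>j i. P i j)" using Q unfolding biquadrangular_def by blast
    then show ?thesis using quadrangularD[of C R "\<lambda>j i. P i j" j k i] k ij True by blast
  next
    case False
    then show ?thesis using Q ij unfolding biquadrangular_def by metis
  qed
qed

lemma orthogonal_support_card2:
  assumes "card R = 2" "card C = 2"
    and rows: "\<And>i j. i \<in> R \<Longrightarrow> j \<in> C \<Longrightarrow> \<exists>k\<in>C. k \<noteq> j \<and> P i k"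
  shows "orthogonal_support R C P"
proof -
  obtain a b where R: "R = {a, b}" "a \<noteq> b" using assms by (meson card_2_iff)
  obtain p q where C: "C = {p, q}" "p \<noteq> q" using assms by (meson card_2_iff)
  have "P a p" "P a q" "P b p" "P b q" using rows unfolding R C by auto
  then show ?thesis
    using orthogonal_support_lists[of "[a, b]" "[p, q]" "[[1, 1], [1, -1]]" P] R C by simp
qed

text \<open>If entry \<open>(a, p)\<close> vanishes, then row \<open>a\<close> and column \<open>p\<close> consist of two ones each. Every other
row meets one of the two ones of row \<open>a\<close> and hence both, so there is no second zero.\<close>

lemma orthogonal_support_card3:
  assumes card: "card R = 3" "card C = 3" and Q: "biquadrangular R C P"
    and rows: "\<And>i j. i \<in> R \<Longrightarrow> j \<in> C \<Longrightarrow> \<exists>k\<in>C. k \<noteq> j \<and> P i k"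
    and cols: "\<And>i j. i \<in> R \<Longrightarrow> j \<in> C \<Longrightarrow> \<exists>k\<in>R. k \<noteq> i \<and> P k j"
  shows "orthogonal_support R C P"
proof (cases "\<forall>i\<in>R. \<forall>j\<in>C. P i j")
  case True
  obtain a b c where R: "R = {a, b, c}" "distinct [a, b, c]" using card by (auto simp: card_3_iff)
  obtain p q r where C: "C = {p, q, r}" "distinct [p, q, r]" using card by (auto simp: card_3_iff)
  show ?thesis
    using orthogonal_support_lists[of "[a, b, c]" "[p, q, r]" "[[1, 2, 2], [2, 1, -2], [2, -2, 1]]" P]
      R C True by simp
next
  case False
  then obtain a p where ap: "a \<in> R" "p \<in> C" "\<not> P a p" by blast
  have "card (R - {a}) = 2" using ap card by simp
  then obtain b c where "R - {a} = {b, c}" "b \<noteq> c" by (meson card_2_iff)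
  then have R: "R = {a, b, c}" "distinct [a, b, c]" using ap by auto
  have "card (C - {p}) = 2" using ap card by simp
  then obtain q r where "C - {p} = {q, r}" "q \<noteq> r" by (meson card_2_iff)
  then have C: "C = {p, q, r}" "distinct [p, q, r]" using ap by auto
  have a: "P a q" "P a r" using rows[of a q] rows[of a r] ap unfolding R C by auto
  have p: "P b p" "P c p" using cols[of b p] cols[of c p] ap unfolding R C by auto
  have full: "P x q \<and> P x r" if "x \<in> {b, c}" for x
  proof -
    have "P x q \<or> P x r" using rows[of x p] that unfolding R C by auto
    moreover have "quadrangular R C P" using Q unfolding biquadrangular_def by blast
    ultimately show ?thesis
      using quadrangularD[of R C P a x q] quadrangularD[of R C P a x r] that a ap R(2) C(2) 
      unfolding R C by auto
  qed
  show ?thesis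
    using orthogonal_support_lists[of "[a, b, c]" "[p, q, r]" "[[0, 1, 1], [1, 1, -1], [2, -1, 1]]" P]
      R C a p ap full by simp
qed

lemma orthogonal_support_of_biquadrangular_le3:
  assumes "finite R" "finite C" "card R = card C" "card R \<le> 3" "biquadrangular R C P"
  shows "orthogonal_support R C P"
  using assms
proof (induction "card R" arbitrary: R C)
  case 0
  then show ?case by (simp add: orthogonal_support_def)
next
  case (Suc n)
  note Q = \<open>biquadrangular R C P\<close>
  show ?case
  proof (cases "\<exists>a\<in>R. \<exists>p\<in>C. \<forall>j\<in>C. P a j \<longleftrightarrow> j = p")
    case True
    then obtain a p where a: "a \<in> R" and p: "p \<in> C" and row: "\<And>j. j \<in> C \<Longrightarrow> P a j \<longleftrightarrow> j = p"
      by blast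
    note iso = biquadrangular_isolated[OF Q a p row]
    have "orthogonal_support (R - {a}) (C - {p}) P"
      by (rule Suc.hyps(1)) (use Suc.hyps(2) Suc.prems a p iso in auto)
    then show ?thesis
      using orthogonal_support_add_isolated[of C a R p P] Suc.prems a p row iso by blast
  next
    case False
    then have ns: "\<And>a p. a \<in> R \<Longrightarrow> p \<in> C \<Longrightarrow> \<exists>j\<in>C. \<not> (P a j \<longleftrightarrow> j = p)" by blast
    note two = biquadrangular_two_ones[OF Q ns]
    have "card R \<noteq> 1"
    proof
      assume "card R = 1"
      then obtain a p where "R = {a}" "C = {p}" using Suc.prems by (metis card_1_singletonE)
      then show False using two(1)[of a p] by auto
    qed
    then consider "card R = 2" | "card R = 3" using Suc.hyps Suc.prems by linarith
    then show ?thesis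
    proof cases
      case 1
      then show ?thesis using orthogonal_support_card2 two(1) Suc.prems by metis
    next
      case 2
      then show ?thesis using orthogonal_support_card3[of R C P] two Q Suc.prems by metis
    qed
  qed
qed

section \<open>Patterns of degree four\<close>

text \<open>The three cases are: some row \<open>x\<close> avoids \<open>{p, q}\<close> (then \<open>x\<close> is \<open>{r, s}\<close>, and the other two
rows are either both full, or split as \<open>{p, q}\<close> and \<open>{r, s}\<close>); all rows contain \<open>{p, q}\<close>
and some other row \<open>x\<close> misses a further column \<open>t\<close>; all rows other than \<open>a\<close> are full. In the second
case two zeros in row \<open>x\<close> would make the rows \<open>a\<close> and \<open>x\<close> both equal to \<open>{p, q}\<close>; together with
a third row they overlap in these two columns only, against strong quadrangularity.\<close>

lemma orthogonal_support_two_entry_row: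
  assumes card: "card R = 4" "card C = 4" and sq: "row_sq R C P" and Q: "biquadrangular R C P"
    and rows: "\<And>i j. i \<in> R \<Longrightarrow> j \<in> C \<Longrightarrow> \<exists>k\<in>C. k \<noteq> j \<and> P i k"
    and cols: "\<And>i j. i \<in> R \<Longrightarrow> j \<in> C \<Longrightarrow> \<exists>k\<in>R. k \<noteq> i \<and> P k j"
    and a: "a \<in> R" and pq: "p \<in> C" "q \<in> C" "p \<noteq> q"
    and row: "\<And>j. j \<in> C \<Longrightarrow> P a j \<longleftrightarrow> j = p \<or> j = q"
  shows "orthogonal_support R C P"
proof -
  have qr: "quadrangular R C P" and qc: "quadrangular C R (\<lambda>j i. P i j)"
    using Q unfolding biquadrangular_def by auto
  have same: "P x p \<longleftrightarrow> P x q" if "x \<in> R" for x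
    using quadrangularD[OF qr a that, of p] quadrangularD[OF qr a that, of q] row pq
    by (cases "x = a") auto
  have others: "\<exists>y z. R = {a, x, y, z} \<and> distinct [a, x, y, z]" if x: "x \<in> R" "x \<noteq> a" for x
  proof -
    have "card (R - {a, x}) = 2" using a x card by (simp add: card_Diff_subset)
    then obtain y z where "R - {a, x} = {y, z}" "y \<noteq> z" by (meson card_2_iff)
    then have "R = {a, x, y, z} \<and> distinct [a, x, y, z]" using a x by auto
    then show ?thesis by blast
  qed
  have "card (C - {p, q}) = 2" using pq card by (simp add: card_Diff_subset)
  then obtain r s where "C - {p, q} = {r, s}" "r \<noteq> s" by (meson card_2_iff)
  then have C: "C = {p, q, r, s}" "distinct [p, q, r, s]" using pq by auto
  have pa: "P a p" "P a q" "\<not> P a r" "\<not> P a s" using row C by auto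
  consider (off) x where "x \<in> R" "\<not> P x p"
    | (miss) x t where "x \<in> R" "x \<noteq> a" "\<forall>y\<in>R. P y p" "t \<in> {r, s}" "\<not> P x t"
    | (full) "\<forall>x\<in>R. P x p" "\<forall>x\<in>R. \<forall>t\<in>{r, s}. x \<noteq> a \<longrightarrow> P x t"
    by blast
  then show ?thesis
  proof cases
    case off
    have xa: "x \<noteq> a" using off pa by auto
    have px: "\<not> P x p" "\<not> P x q" "P x r" "P x s"
      using off same[of x] rows[of x r] rows[of x s] C by auto
    obtain y where y: "y \<in> R" "y \<noteq> a" "P y p" using cols[of a p] a pq by auto
    have "y \<noteq> x" using y px by auto
    then obtain z where R: "R = {a, x, y, z}" "distinct [a, x, y, z]"
      using others[of x] off xa y by auto
    have "P y q" using same y by simp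
    have zp: "P z q \<longleftrightarrow> P z p" using same R by simp
    \<comment> \<open>Columns \<open>p\<close> and \<open>t\<close> can only meet in rows \<open>y\<close> and \<open>z\<close>, and if they meet at all, they meet in
      both.\<close>
    have link: "P y t \<longleftrightarrow> P z p \<and> P z t" "P z p \<Longrightarrow> P z t" if t: "t \<in> {r, s}" for t
    proof -
      have tp: "t \<in> C" "p \<noteq> t" using t C by auto
      have two: "P y t \<or> P z t" using cols[of x t] tp t pa unfolding R by auto
      show "P z p \<Longrightarrow> P z t"
        using two quadrangularD[OF qc pq(1) tp, of y] tp t pa px R y by auto
      then show "P y t \<longleftrightarrow> P z p \<and> P z t"
        using quadrangularD[OF qc pq(1) tp, of y] quadrangularD[OF qc pq(1) tp, of z] tp t pa px R y by auto
    qed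
    show ?thesis
    proof (cases "P z p")
      case True
      then have "P y r" "P y s" "P z r" "P z s" using link by auto
      then show ?thesis
        using True orthogonal_support_lists[of "[a, x, y, z]" "[p, q, r, s]"
            "[[1, 1, 0, 0], [0, 0, 1, 1], [1, -1, 1, -1], [1, -1, -1, 1]]" P]
          R C pa px y \<open>P y q\<close> zp by simp
    next
      case False
      have "P z r" "P z s" using False rows[of z r] rows[of z s] zp R C by auto
      moreover have "\<not> P y r" "\<not> P y s" using False link by auto
      ultimately show ?thesis
        using orthogonal_support_lists[of "[a, y, x, z]" "[p, q, r, s]"
            "[[1, 1, 0, 0], [1, -1, 0, 0], [0, 0, 1, 1], [0, 0, 1, -1]]" P]
          R C pa px y \<open>P y q\<close> \<open>y \<noteq> x\<close> zp False by (simp add: insert_commute)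
    qed
  next
    case miss
    obtain y z where R: "R = {a, x, y, z}" "distinct [a, x, y, z]" using others miss by blast
    obtain u where u: "C = {p, q, u, t}" "distinct [p, q, u, t]"
      using C miss(4) by (auto simp: insert_commute)
    have pa': "\<not> P a u" "\<not> P a t" using row u by auto
    have pp: "P x p" "P x q" "P y p" "P y q" "P z p" "P z q" using miss same R by auto
    have t: "P y t" "P z t" using cols[of z t] cols[of y t] pa' miss u R by auto
    have xu: "P x u"
    proof (rule ccontr)
      assume nu: "\<not> P x u"
      have "{a, x, y} \<subseteq> R" using R by auto
      moreover have "\<forall>v\<in>{a, x, y}. \<exists>w\<in>{a, x, y}. w \<noteq> v \<and> (\<exists>j\<in>C. P v j \<and> P w j)"
        using pa pp R pq by auto
      ultimately have "card {a, x, y} \<le> card {j\<in>C. 2 \<le> card {i\<in>{a, x, y}. P i j}}"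
        using row_sqD[OF sq] by blast
      also have "{j\<in>C. 2 \<le> card {i\<in>{a, x, y}. P i j}} \<subseteq> {p, q}"
      proof
        fix j assume j: "j \<in> {j\<in>C. 2 \<le> card {i\<in>{a, x, y}. P i j}}"
        then obtain i where "i \<in> {a, x, y}" "P i j" "i \<noteq> y" using two_le_cardD[of _ y] by blast
        then show "j \<in> {p, q}" using j nu miss pa' u by auto
      qed
      then have "card {j\<in>C. 2 \<le> card {i\<in>{a, x, y}. P i j}} \<le> card {p, q}"
        by (intro card_mono) auto
      finally show False using R pq by simp
    qed
    have "P y u \<or> P z u" using cols[of x u] pa' R u by auto
    moreover have "t \<in> C" "u \<in> C" "t \<noteq> u" using u by auto
    ultimately have yzu: "P y u" "P z u"
      using quadrangularD[OF qc, of t u y] quadrangularD[OF qc, of t u z] t pa' miss(5) R by auto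
    show ?thesis
      using orthogonal_support_lists[of "[a, x, y, z]" "[p, q, u, t]"
          "[[1, 1, 0, 0], [1, -1, 1, 0], [1, -1, -2, 2], [1, -1, -2, -3]]" P]
        R u pa pa' pp t xu yzu miss by simp
  next
    case full
    obtain b where "b \<in> R" "b \<noteq> a" using cols[of a p] a pq by auto
    then obtain c d where R: "R = {a, b, c, d}" "distinct [a, b, c, d]" using others by blast
    have "\<forall>x\<in>{b, c, d}. P x p \<and> P x q \<and> P x r \<and> P x s" using full same R by auto
    then show ?thesis
      using orthogonal_support_lists[of "[a, b, c, d]" "[p, q, r, s]"
          "[[1, 1, 0, 0], [1, -1, 1, 2], [1, -1, 2, -2], [3, -3, -4, -1]]" P]
        R C pa by simp
  qed
qed

text \<open>A relation with at most one entry in each row and each column is a partial injection; the rows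
and columns that it leaves out are equal in number and can be matched arbitrarily.\<close>

lemma partial_matching_extends:
  assumes fin: "finite R" "finite C" and card: "card R = card C"
    and row: "\<And>i j k. i \<in> R \<Longrightarrow> j \<in> C \<Longrightarrow> k \<in> C \<Longrightarrow> Z i j \<Longrightarrow> Z i k \<Longrightarrow> j = k"
    and col: "\<And>i j k. i \<in> R \<Longrightarrow> k \<in> R \<Longrightarrow> j \<in> C \<Longrightarrow> Z i j \<Longrightarrow> Z k j \<Longrightarrow> i = k"
  obtains f where "bij_betw f R C" "\<And>i j. i \<in> R \<Longrightarrow> j \<in> C \<Longrightarrow> Z i j \<Longrightarrow> j = f i"
proof -
  define R0 where "R0 = {i\<in>R. \<exists>j\<in>C. Z i j}"
  define g where "g i = (SOME j. j \<in> C \<and> Z i j)" for i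
  have g: "g i \<in> C" "Z i (g i)" if "i \<in> R0" for i
    using that someI_ex[of "\<lambda>j. j \<in> C \<and> Z i j"] unfolding R0_def g_def by auto
  have sub: "R0 \<subseteq> R" "g ` R0 \<subseteq> C" using g by (auto simp: R0_def)
  have inj: "inj_on g R0"
    by (intro inj_onI) (metis g col sub subsetD)
  have "card (R - R0) = card (C - g ` R0)"
    using sub fin card inj by (simp add: card_Diff_subset finite_subset card_image)
  then obtain h where h: "bij_betw h (R - R0) (C - g ` R0)"
    using fin finite_same_card_bij[of "R - R0" "C - g ` R0"] by auto
  define f where "f i = (if i \<in> R0 then g i else h i)" for i
  have "bij_betw f R0 (g ` R0)"
    using inj by (auto simp: bij_betw_def f_def inj_on_def)
  moreover have "bij_betw f (R - R0) (C - g ` R0)"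
    using h by (subst bij_betw_cong[of _ _ h]) (auto simp: f_def)
  ultimately have "bij_betw f (R0 \<union> (R - R0)) (g ` R0 \<union> (C - g ` R0))"
    by (rule bij_betw_combine) auto
  then have "bij_betw f R C" using sub by (simp add: Un_absorb1)
  moreover have "j = f i" if "i \<in> R" "j \<in> C" "Z i j" for i j
  proof -
    have "i \<in> R0" using that by (auto simp: R0_def)
    then show ?thesis using row[of i j "g i"] g that by (simp add: f_def)
  qed
  ultimately show ?thesis using that by blast
qed

text \<open>A bijection \<open>f\<close> from rows to columns passes through all zeros. Listing first the rows whose zero
occurs, and the columns in the order given by \<open>f\<close>, moves the zeros to the initial part of the
diagonal, and their number determines the pattern.\<close>

lemma orthogonal_support_scattered_zeros:
  assumes card: "card R = 4" "card C = 4"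
    and row: "\<And>i j k. i \<in> R \<Longrightarrow> j \<in> C \<Longrightarrow> k \<in> C \<Longrightarrow> \<not> P i j \<Longrightarrow> \<not> P i k \<Longrightarrow> j = k"
    and col: "\<And>i j k. i \<in> R \<Longrightarrow> k \<in> R \<Longrightarrow> j \<in> C \<Longrightarrow> \<not> P i j \<Longrightarrow> \<not> P k j \<Longrightarrow> i = k"
  shows "orthogonal_support R C P"
proof -
  have fin: "finite R" "finite C" using card by (metis card.infinite zero_neq_numeral)+
  obtain f where f: "bij_betw f R C" "\<And>i j. i \<in> R \<Longrightarrow> j \<in> C \<Longrightarrow> \<not> P i j \<Longrightarrow> j = f i"
    using partial_matching_extends[of R C "\<lambda>i j. \<not> P i j"] fin card row col by auto
  define R0 where "R0 = {i\<in>R. \<not> P i (f i)}"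
  obtain xs where xs: "set xs = R0" "distinct xs"
    using finite_distinct_list[of R0] fin by (auto simp: R0_def)
  obtain ys where ys: "set ys = R - R0" "distinct ys"
    using finite_distinct_list[of "R - R0"] fin by auto
  have d: "distinct (xs @ ys)" and R: "set (xs @ ys) = R" using xs ys by (auto simp: R0_def)
  then have len: "length xs + length ys = 4" using distinct_card[OF d] card by simp
  have d': "distinct (map f (xs @ ys))"
    using d bij_betw_imp_inj_on[OF f(1)] unfolding R[symmetric] distinct_map by blast
  have C: "set (map f (xs @ ys)) = C"
    using bij_betw_imp_surj_on[OF f(1)] R by (metis set_map)
  have inj: "f i = f k \<longleftrightarrow> i = k" if "i \<in> R" "k \<in> R" for i k
    using f(1) that by (auto simp: bij_betw_def inj_on_def)
  have P: "P i (f k) \<longleftrightarrow> \<not> (i = k \<and> i \<in> R0)" if "i \<in> R" "k \<in> R" for i k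
  proof (cases "i = k")
    case False
    have "f k \<in> C" using f(1) that by (auto simp: bij_betw_def)
    then show ?thesis using f(2)[of i "f k"] inj[of i k] that False by metis
  qed (use that in \<open>simp add: R0_def\<close>)
  have P': "P i (f k) \<longleftrightarrow> \<not> (i = k \<and> i \<in> set xs)" if "i \<in> set (xs @ ys)" "k \<in> set (xs @ ys)" for i k
    using P R xs that by simp
  note support = orthogonal_support_lists[OF d d', unfolded R C, of _ P]
  consider "length xs = 0" "length ys = 4" | "length xs = 1" "length ys = 3"
    | "length xs = 2" "length ys = 2" | "length xs = 3" "length ys = 1"
    | "length xs = 4" "length ys = 0"
    using len by linarith
  then show ?thesis
  proof cases
    case 1
    show ?thesis
      by (rule support[of "[[1, 1, 1, 1], [1, 1, -1, -1], [1, -1, 1, -1], [1, -1, -1, 1]]"])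
        (use 1 d P' in \<open>auto simp: numeral_eq_Suc length_Suc_conv\<close>)
  next
    case 2
    show ?thesis
      by (rule support[of "[[0, 1, 1, 1], [1, 1, 1, -2], [3, 1, -2, 1], [3, -4, 3, 1]]"])
        (use 2 d P' in \<open>auto simp: numeral_eq_Suc length_Suc_conv\<close>)
  next
    case 3
    show ?thesis
      by (rule support[of "[[0, 1, 1, 1], [1, 0, 1, -1], [1, 3, -2, -1], [3, -1, -1, 2]]"])
        (use 3 d P' in \<open>auto simp: numeral_eq_Suc length_Suc_conv\<close>)
  next
    case 4
    show ?thesis
      by (rule support[of "[[0, 1, 1, 1], [2, 0, 1, -1], [1, -2, 0, 2], [2, 2, -3, 1]]"])
        (use 4 d P' in \<open>auto simp: numeral_eq_Suc length_Suc_conv\<close>)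
  next
    case 5
    show ?thesis
      by (rule support[of "[[0, 1, 1, 1], [1, 0, 1, -1], [1, -1, 0, 1], [1, 1, -1, 0]]"])
        (use 5 d P' in \<open>auto simp: numeral_eq_Suc length_Suc_conv\<close>)
  qed
qed

text \<open>The disjunction accommodates a column with exactly two ones, which is treated as a row of the
transposed pattern. Passing from orthogonal rows back to orthogonal columns needs a square unitary
matrix and is left to the level of matrices.\<close>

lemma orthogonal_support_or_transpose_card4:
  assumes card: "card R = 4" "card C = 4"
    and sq: "row_sq R C P" "row_sq C R (\<lambda>j i. P i j)" and Q: "biquadrangular R C P"
  shows "orthogonal_support R C P \<or> orthogonal_support C R (\<lambda>j i. P i j)"
proof -
  have fin: "finite R" "finite C" using card by (metis card.infinite zero_neq_numeral)+
  have Q': "biquadrangular C R (\<lambda>j i. P i j)" using Q unfolding biquadrangular_def by blast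
  show ?thesis
  proof (cases "\<exists>a\<in>R. \<exists>p\<in>C. \<forall>j\<in>C. P a j \<longleftrightarrow> j = p")
    case True
    then obtain a p where a: "a \<in> R" and p: "p \<in> C" and row: "\<And>j. j \<in> C \<Longrightarrow> P a j \<longleftrightarrow> j = p"
      by blast
    note iso = biquadrangular_isolated[OF Q a p row]
    have "orthogonal_support (R - {a}) (C - {p}) P"
      by (rule orthogonal_support_of_biquadrangular_le3) (use fin card a p iso in auto)
    then have "orthogonal_support R C P"
      using orthogonal_support_add_isolated[of C a R p P] fin a p row iso by blast
    then show ?thesis ..
  next
    case False
    then have ns: "\<And>a p. a \<in> R \<Longrightarrow> p \<in> C \<Longrightarrow> \<exists>j\<in>C. \<not> (P a j \<longleftrightarrow> j = p)" by blast
    note two = biquadrangular_two_ones[OF Q ns]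
    \<comment> \<open>Two zeros in a line of length four with at least two ones leave exactly two ones.\<close>
    have two_zeros: "\<exists>l\<in>A. \<exists>m\<in>A. l \<noteq> m \<and> (\<forall>x\<in>A. f x \<longleftrightarrow> x = l \<or> x = m)"
      if A: "card A = 4" "j \<in> A" "k \<in> A" "j \<noteq> k" "\<not> f j" "\<not> f k"
        and f: "\<And>x. x \<in> A \<Longrightarrow> \<exists>y\<in>A. y \<noteq> x \<and> f y" for A :: "'c set" and f j k
    proof -
      have "card (A - {j, k}) = 2" using A by (simp add: card_Diff_subset)
      then obtain l m where "A - {j, k} = {l, m}" "l \<noteq> m" by (meson card_2_iff)
      then have eq: "A = {j, k, l, m}" "distinct [j, k, l, m]" using A by auto
      have "f l" "f m" using f[of m] f[of l] A unfolding eq by auto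
      then show ?thesis using A eq by auto
    qed
    consider (row) a p q where "a \<in> R" "p \<in> C" "q \<in> C" "p \<noteq> q" "\<forall>j\<in>C. P a j \<longleftrightarrow> j = p \<or> j = q"
      | (col) p a b where "p \<in> C" "a \<in> R" "b \<in> R" "a \<noteq> b" "\<forall>i\<in>R. P i p \<longleftrightarrow> i = a \<or> i = b"
      | (none) "\<forall>i\<in>R. \<forall>p\<in>C. \<forall>q\<in>C. p \<noteq> q \<longrightarrow> \<not> (\<forall>j\<in>C. P i j \<longleftrightarrow> j = p \<or> j = q)"
        "\<forall>j\<in>C. \<forall>a\<in>R. \<forall>b\<in>R. a \<noteq> b \<longrightarrow> \<not> (\<forall>i\<in>R. P i j \<longleftrightarrow> i = a \<or> i = b)"
      by blast
    then show ?thesis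
    proof cases
      case row
      have "orthogonal_support R C P"
        by (rule orthogonal_support_two_entry_row[OF card sq(1) Q two row(1-4)]) (use row in auto)
      then show ?thesis ..
    next
      case col
      have "orthogonal_support C R (\<lambda>j i. P i j)"
        by (rule orthogonal_support_two_entry_row[OF card(2,1) sq(2) Q' two(2,1) col(1-4)])
          (use col in auto)
      then show ?thesis ..
    next
      case none
      have "orthogonal_support R C P"
      proof (rule orthogonal_support_scattered_zeros[OF card])
        show "j = k" if "i \<in> R" "j \<in> C" "k \<in> C" "\<not> P i j" "\<not> P i k" for i j k
          using two_zeros[of C j k "P i"] two(1) none(1) card that by metis
        show "i = k" if "i \<in> R" "k \<in> R" "j \<in> C" "\<not> P i j" "\<not> P k j" for i j k
          using two_zeros[of R i k "\<lambda>i. P i j"] two(2) none(2) card that by metis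
      qed
      then show ?thesis ..
    qed
  qed
qed

section \<open>Unitary matrices\<close>

lemma mult_adjoint_index:
  fixes A B :: "complex mat"
  assumes "A \<in> carrier_mat n n" "B \<in> carrier_mat n n" "i < n" "k < n"
  shows "(A * mat_adjoint B) $$ (i, k) = (\<Sum>j<n. A $$ (i, j) * cnj (B $$ (k, j)))"
    and "(mat_adjoint B * A) $$ (i, k) = (\<Sum>j<n. cnj (B $$ (j, i)) * A $$ (j, k))"
  using assms by (auto simp: mat_adjoint_def mat_of_rows_def scalar_prod_def atLeast0LessThan)

lemma mat_adjoint_carrier:
  fixes U :: "complex mat"
  shows "U \<in> carrier_mat n n \<Longrightarrow> mat_adjoint U \<in> carrier_mat n n"
  by (auto simp: mat_adjoint_def)

text \<open>Orthonormality of the rows suffices, since a one-sided inverse of a square matrix is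
two-sided.\<close>

lemma unitary_mat_iff_rows:
  assumes U: "U \<in> carrier_mat n n"
  shows "unitary_mat U \<longleftrightarrow>
    (\<forall>i<n. \<forall>k<n. (\<Sum>j<n. U $$ (i, j) * cnj (U $$ (k, j))) = (if i = k then 1 else 0))"
proof -
  note U' = mat_adjoint_carrier[OF U]
  have "unitary_mat U \<longleftrightarrow> U * mat_adjoint U = 1\<^sub>m n"
    using U U' mat_mult_left_right_inverse[OF U U']
    unfolding unitary_mat_def inverts_mat_def by auto
  also have "\<dots> \<longleftrightarrow> (\<forall>i<n. \<forall>k<n. (U * mat_adjoint U) $$ (i, k) = 1\<^sub>m n $$ (i, k))"
    using U U' by (auto simp: mat_eq_iff)
  also have "\<dots> \<longleftrightarrow> (\<forall>i<n. \<forall>k<n. (\<Sum>j<n. U $$ (i, j) * cnj (U $$ (k, j))) = (if i = k then 1 else 0))"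
    by (auto simp: mult_adjoint_index(1)[OF U U])
  finally show ?thesis .
qed

lemma unitary_mat_transpose:
  assumes U: "U \<in> carrier_mat n n" and "unitary_mat U"
  shows "unitary_mat U\<^sup>T"
proof -
  have inv: "mat_adjoint U * U = 1\<^sub>m n"
    using assms mat_adjoint_carrier[OF U] unfolding unitary_mat_def inverts_mat_def by auto
  have "(\<Sum>j<n. U $$ (j, i) * cnj (U $$ (j, k))) = (if i = k then 1 else 0)" if "i < n" "k < n" for i k
    using mult_adjoint_index(2)[OF U U that(2,1)] that unfolding inv by (auto simp: mult.commute)
  then show ?thesis using U by (subst unitary_mat_iff_rows[of _ n]) auto
qed

lemma supports_unitary_transpose:
  assumes M: "M \<in> carrier_mat n n" and "supports_unitary M"
  shows "supports_unitary M\<^sup>T"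
proof -
  obtain U where "U \<in> carrier_mat n n" "unitary_mat U"
    "\<forall>i<n. \<forall>j<n. U $$ (i, j) \<noteq> 0 \<longleftrightarrow> M $$ (i, j) = 1"
    using assms unfolding supports_unitary_def by auto
  then show ?thesis
    using M unitary_mat_transpose[of U n] unfolding supports_unitary_def
    by (intro bexI[of _ "U\<^sup>T"]) auto
qed

text \<open>Rows with at least one nonzero entry can be divided by their lengths.\<close>

lemma supports_unitary_iff_orthogonal_support:
  assumes M: "M \<in> carrier_mat n n" and nz: "\<And>i. i < n \<Longrightarrow> \<exists>j<n. M $$ (i, j) = 1"
  shows "supports_unitary M \<longleftrightarrow> orthogonal_support {..<n} {..<n} (\<lambda>i j. M $$ (i, j) = 1)"
proof
  assume "supports_unitary M"
  then obtain U where U: "U \<in> carrier_mat n n" "unitary_mat U"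
    "\<forall>i<n. \<forall>j<n. U $$ (i, j) \<noteq> 0 \<longleftrightarrow> M $$ (i, j) = 1"
    using M unfolding supports_unitary_def by auto
  then show "orthogonal_support {..<n} {..<n} (\<lambda>i j. M $$ (i, j) = 1)"
    unfolding orthogonal_support_def unitary_mat_iff_rows[OF U(1)]
    by (intro exI[of _ "\<lambda>i j. U $$ (i, j)"]) auto
next
  assume "orthogonal_support {..<n} {..<n} (\<lambda>i j. M $$ (i, j) = 1)"
  then obtain V :: "nat \<Rightarrow> nat \<Rightarrow> complex" where
    V: "\<forall>i\<in>{..<n}. \<forall>k\<in>{..<n}. i \<noteq> k \<longrightarrow> (\<Sum>j\<in>{..<n}. V i j * cnj (V k j)) = 0"
      "\<forall>i\<in>{..<n}. \<forall>j\<in>{..<n}. V i j \<noteq> 0 \<longleftrightarrow> M $$ (i, j) = 1"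
    unfolding orthogonal_support_def by (elim exE conjE)
  have orth: "(\<Sum>j<n. V i j * cnj (V k j)) = 0" if "i < n" "k < n" "i \<noteq> k" for i k
    using V(1) that by simp
  have supp: "V i j \<noteq> 0 \<longleftrightarrow> M $$ (i, j) = 1" if "i < n" "j < n" for i j
    using V(2) that by simp
  define N where "N i = (\<Sum>j<n. (cmod (V i j))\<^sup>2)" for i
  have Npos: "N i > 0" if i: "i < n" for i
  proof -
    obtain j where "j < n" "V i j \<noteq> 0" using nz[OF i] supp i by blast
    then show ?thesis unfolding N_def by (intro sum_pos2[of _ j]) auto
  qed
  define U where "U = mat n n (\<lambda>(i, j). V i j / of_real (sqrt (N i)))"
  have U: "U \<in> carrier_mat n n" by (simp add: U_def)
  have "(\<Sum>j<n. U $$ (i, j) * cnj (U $$ (k, j))) = (if i = k then 1 else 0)"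
    if ik: "i < n" "k < n" for i k
  proof -
    have "(\<Sum>j<n. U $$ (i, j) * cnj (U $$ (k, j))) =
        (\<Sum>j<n. V i j * cnj (V k j)) / (of_real (sqrt (N i)) * of_real (sqrt (N k)))"
      using ik by (simp add: U_def sum_divide_distrib)
    also have "\<dots> = (if i = k then 1 else 0)"
    proof (cases "i = k")
      case True
      have "(\<Sum>j<n. V i j * cnj (V i j)) = of_real (N i)"
        unfolding N_def by (simp only: of_real_sum complex_norm_square)
      moreover have "complex_of_real (sqrt (N i)) * of_real (sqrt (N i)) = of_real (N i)"
        using Npos[OF ik(1)] by (simp flip: of_real_mult)
      ultimately show ?thesis using True Npos[OF ik(1)] by simp
    qed (use orth ik in simp)
    finally show ?thesis .
  qed
  then have "unitary_mat U" unfolding unitary_mat_iff_rows[OF U] by blast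
  moreover have "U $$ (i, j) \<noteq> 0 \<longleftrightarrow> M $$ (i, j) = 1" if "i < n" "j < n" for i j
    using supp[OF that] Npos[OF that(1)] that by (simp add: U_def)
  ultimately show "supports_unitary M" using U M unfolding supports_unitary_def by auto
qed

lemma zero_one_row_product:
  assumes M: "M \<in> carrier_mat n n" and "zero_one_mat M" and "u < n" "v < n"
  shows "row M u \<bullet> row M v \<noteq> 0 \<longleftrightarrow> (\<exists>j<n. M $$ (u, j) = 1 \<and> M $$ (v, j) = 1)"
proof -
  have zo: "M $$ (i, j) = 0 \<or> M $$ (i, j) = 1" if "i < n" "j < n" for i j
    using assms that elements_matI[OF M that] unfolding zero_one_mat_def by blast
  have "row M u \<bullet> row M v = (\<Sum>j<n. M $$ (u, j) * M $$ (v, j))"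
    using assms by (simp add: scalar_prod_def atLeast0LessThan)
  moreover have "(\<Sum>j<n. M $$ (u, j) * M $$ (v, j)) = 0 \<longleftrightarrow> (\<forall>j\<in>{..<n}. M $$ (u, j) * M $$ (v, j) = 0)"
    using zo[OF assms(3)] zo[OF assms(4)] by (intro sum_nonneg_eq_0_iff) fastforce+
  moreover have "M $$ (u, j) * M $$ (v, j) = 0 \<longleftrightarrow> \<not> (M $$ (u, j) = 1 \<and> M $$ (v, j) = 1)"
    if "j < n" for j
    using zo[OF assms(3) that] zo[OF assms(4) that] by auto
  ultimately show ?thesis by auto
qed

lemma row_strongly_quadrangular_iff_row_sq:
  assumes M: "M \<in> carrier_mat n n" and zo: "zero_one_mat M"
  shows "row_strongly_quadrangular M \<longleftrightarrow> row_sq {..<n} {..<n} (\<lambda>i j. M $$ (i, j) = 1)"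
proof -
  have "(\<forall>u\<in>S. \<exists>v\<in>S. v \<noteq> u \<and> row M u \<bullet> row M v \<noteq> 0) \<longleftrightarrow>
      (\<forall>u\<in>S. \<exists>v\<in>S. v \<noteq> u \<and> (\<exists>j\<in>{..<n}. M $$ (u, j) = 1 \<and> M $$ (v, j) = 1))"
    if S: "S \<subseteq> {..<n}" for S
    using zero_one_row_product[OF M zo] S by (intro ball_cong bex_cong refl) (auto simp: Bex_def)
  then show ?thesis using M unfolding row_strongly_quadrangular_def row_sq_def by auto
qed

theorem proposition2p4:
  fixes n :: nat and M :: "int mat"
  assumes "0 < n" and "n \<le> 4"
    and "M \<in> carrier_mat n n"
    and "zero_one_mat M"
    and "\<forall>i < n. row M i \<noteq> 0\<^sub>v n"
    and "\<forall>j < n. col M j \<noteq> 0\<^sub>v n"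
  shows "supports_unitary M \<longleftrightarrow> strongly_quadrangular M"
proof -
  note M = assms(3) and zo = assms(4)
  have MT: "M\<^sup>T \<in> carrier_mat n n" using M by simp
  have entry: "M $$ (i, j) = 0 \<or> M $$ (i, j) = 1" if "i < n" "j < n" for i j
    using zo elements_matI[OF M that] unfolding zero_one_mat_def by blast
  have zoT: "zero_one_mat M\<^sup>T"
    unfolding zero_one_mat_def
  proof
    fix x assume "x \<in> elements_mat M\<^sup>T"
    then obtain i j where "i < n" "j < n" "x = M $$ (i, j)" using elements_matD[of x "M\<^sup>T"] M by auto
    then show "x \<in> {0, 1}" using entry by blast
  qed
  define P where "P i j \<longleftrightarrow> M $$ (i, j) = 1" for i j
  have rows: "\<exists>j<n. P i j" if "i < n" for i
  proof (rule ccontr)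
    assume "\<not> ?thesis"
    then have "row M i = 0\<^sub>v n" using entry[OF that] M that by (intro eq_vecI) (auto simp: P_def)
    then show False using assms(5) that by blast
  qed
  have cols: "\<exists>i<n. P i j" if "j < n" for j
  proof (rule ccontr)
    assume "\<not> ?thesis"
    then have "col M j = 0\<^sub>v n" using entry[of _ j] M that by (intro eq_vecI) (auto simp: P_def)
    then show False using assms(6) that by blast
  qed
  have PT: "M\<^sup>T $$ (j, i) = 1 \<longleftrightarrow> P i j" if "i < n" "j < n" for i j
    using M that by (simp add: P_def)
  have sq: "row_strongly_quadrangular M \<longleftrightarrow> row_sq {..<n} {..<n} P"
    using row_strongly_quadrangular_iff_row_sq[OF M zo] unfolding P_def .
  have os: "supports_unitary M \<longleftrightarrow> orthogonal_support {..<n} {..<n} P"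
    using supports_unitary_iff_orthogonal_support[OF M] rows unfolding P_def by blast
  have sqT: "row_strongly_quadrangular M\<^sup>T \<longleftrightarrow> row_sq {..<n} {..<n} (\<lambda>j i. P i j)"
  proof -
    have "{j\<in>{..<n}. 2 \<le> card {i\<in>S. M\<^sup>T $$ (i, j) = 1}} = {j\<in>{..<n}. 2 \<le> card {i\<in>S. P j i}}"
      if "S \<subseteq> {..<n}" for S
      using that PT by (intro Collect_cong conj_cong refl arg_cong[where f = "\<lambda>A. 2 \<le> card A"]) auto
    moreover have "(\<forall>u\<in>S. \<exists>v\<in>S. v \<noteq> u \<and> (\<exists>j\<in>{..<n}. M\<^sup>T $$ (u, j) = 1 \<and> M\<^sup>T $$ (v, j) = 1)) \<longleftrightarrow>
      (\<forall>u\<in>S. \<exists>v\<in>S. v \<noteq> u \<and> (\<exists>j\<in>{..<n}. P j u \<and> P j v))" if "S \<subseteq> {..<n}" for S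
      using that PT by (intro ball_cong bex_cong refl conj_cong) auto
    ultimately show ?thesis
      unfolding row_strongly_quadrangular_iff_row_sq[OF MT zoT] row_sq_def by auto
  qed
  have osT: "supports_unitary M\<^sup>T \<longleftrightarrow> orthogonal_support {..<n} {..<n} (\<lambda>j i. P i j)"
  proof -
    have "supports_unitary M\<^sup>T \<longleftrightarrow> orthogonal_support {..<n} {..<n} (\<lambda>i j. M\<^sup>T $$ (i, j) = 1)"
      using supports_unitary_iff_orthogonal_support[OF MT] cols PT by blast
    also have "\<dots> \<longleftrightarrow> orthogonal_support {..<n} {..<n} (\<lambda>j i. P i j)"
      unfolding orthogonal_support_def using PT by (intro ex_cong1 conj_cong ball_cong refl) auto
    finally show ?thesis .
  qed
  have T: "supports_unitary M \<longleftrightarrow> supports_unitary M\<^sup>T"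
    using supports_unitary_transpose[OF M] supports_unitary_transpose[OF MT] by auto
  show ?thesis
  proof
    assume "supports_unitary M"
    then show "strongly_quadrangular M"
      using T os osT sq sqT orthogonal_support_imp_row_sq[of "{..<n}" "{..<n}"]
      unfolding strongly_quadrangular_def by blast
  next
    assume "strongly_quadrangular M"
    then have sqs: "row_sq {..<n} {..<n} P" "row_sq {..<n} {..<n} (\<lambda>j i. P i j)"
      using sq sqT unfolding strongly_quadrangular_def by auto
    have Q: "biquadrangular {..<n} {..<n} P"
      unfolding biquadrangular_def
      using sqs[THEN row_sq_imp_quadrangular] rows cols by auto
    show "supports_unitary M"
    proof (cases "n = 4")
      case True
      then show ?thesis
        using orthogonal_support_or_transpose_card4[OF _ _ sqs Q] T os osT by auto
    next
      case False
      then show ?thesis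
        using orthogonal_support_of_biquadrangular_le3[OF _ _ _ _ Q] assms(2) os by auto
    qed
  qed
qed

end
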